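(* Let $q \ge 1$ and $a$ be fixed integers, and for each $n$ let $A = \{ m \in \{1,\dots,n\} : m \equiv a \pmod q\}$ and $A/A = \{x/y : x,y \in A\}$. Then, as $n \to \infty$, $$|A/A| \sim c_q \frac{n^2}{q^2}, \qquad \text{where } c_q = \frac{6}{\pi^2} \prod_{p \mid q}\left(1 - \frac{1}{p^2}\right)^{-1} \sum_{\substack{1 \le t \le q \\ \gcd(t,q)=1}} \frac{1}{t^2},$$ the product running over the primes $p$ dividing $q$.
   Formalization: The assumption gcd(a,q) = 1 is added; without it the claim is false: for q = 2, a = 0 one gets |A/A| ~ (6/π²) n²/4, whereas c_2 = 8/π². *)

theory Defs
  imports
    "HOL-Library.Landau_Symbols"
    "HOL-Number_Theory.Cong"
    "HOL-Computational_Algebra.Primes"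
begin

definition ap_upto :: "int \<Rightarrow> int \<Rightarrow> nat \<Rightarrow> int set"
  where "ap_upto q a n = {m \<in> {1..int n}. [m = a] (mod q)}"

definition ratio_set :: "int set \<Rightarrow> rat set"
  where "ratio_set A = {of_int x / of_int y | x y. x \<in> A \<and> y \<in> A}"

(* For q >= 1 both index sets are finite; primes in type int are positive.
   This is the constant for a residue class a mod q with coprime a q.  A common divisor d of
   a and q cancels in the quotients, so in general the constant would be ratio_const (q div d);
   e.g. q = 2, a = 0 gives 6 / pi^2, whereas ratio_const 2 = 8 / pi^2. *)
definition ratio_const :: "int \<Rightarrow> real"
  where "ratio_const q =
    6 / pi ^ 2
    * (\<Prod>p | prime p \<and> p dvd q. inverse (1 - 1 / of_int p ^ 2))
    * (\<Sum>t | 1 \<le> t \<and> t \<le> q \<and> coprime t q. 1 / of_int t ^ 2)"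

end

theory Submission
  imports Defs "HOL-Analysis.Analysis"
begin

text \<open>
  A reduced fraction r/s lies in A/A iff t max(r, s) \<le> n, where t is the unique element of
  {1..q} with t r \<equiv> t s \<equiv> a (mod q). So |A/A| is the sum over the units t of the number
  P(t, n/t) of coprime pairs in the box of side n/t solving these congruences. Sorting all pairs
  by their gcd g gives, for every unit u,
  S(u, x)^2 = sum over g coprime to q of P(u g, x/g), where S(u, x) = x/q + O(1).
  Instead of inverting this with the Moebius function, let Z be the sum of 1/g^2 over g coprime
  to q. If |P(u, x)/x^2 - 1/(q^2 Z)| has limsup c, uniformly in u, then solving for the term g = 1
  yields c \<le> (Z - 1) c, and Z \<le> pi^2/6 < 2 forces c = 0.
\<close>

section \<open>Congruence-restricted points and coprime pairs in a box\<close>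

text \<open>The bound \<open>x\<close> is real so that boxes of side \<open>n / t\<close> and
  \<open>x / g\<close> can be used without rounding. The multiplier \<open>u\<close> stays a
  parameter because dividing out a gcd \<open>g\<close> replaces \<open>u\<close> by
  \<open>u * g\<close>.\<close>

definition coprime_pairs :: "int \<Rightarrow> int \<Rightarrow> int \<Rightarrow> real \<Rightarrow> (int \<times> int) set"
  where "coprime_pairs q a u x =
    {(r, s). 1 \<le> r \<and> 1 \<le> s \<and> of_int r \<le> x \<and> of_int s \<le> x \<and> coprime r s
      \<and> [u * r = a] (mod q) \<and> [u * s = a] (mod q)}"

definition solutions_upto :: "int \<Rightarrow> int \<Rightarrow> int \<Rightarrow> real \<Rightarrow> int set"
  where "solutions_upto q a u x = {m. 1 \<le> m \<and> of_int m \<le> x \<and> [u * m = a] (mod q)}"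

lemma finite_coprime_pairs [simp]: "finite (coprime_pairs q a u x)"
  by (rule finite_subset[of _ "{1..\<lfloor>x\<rfloor>} \<times> {1..\<lfloor>x\<rfloor>}"])
     (auto simp: coprime_pairs_def le_floor_iff)

lemma finite_solutions_upto [simp]: "finite (solutions_upto q a u x)"
  by (rule finite_subset[of _ "{1..\<lfloor>x\<rfloor>}"])
     (auto simp: solutions_upto_def le_floor_iff)

lemma card_coprime_pairs_le:
  assumes "x \<ge> 0"
  shows "real (card (coprime_pairs q a u x)) \<le> x\<^sup>2"
proof -
  have "card (coprime_pairs q a u x) \<le> card ({1..\<lfloor>x\<rfloor>} \<times> {1..\<lfloor>x\<rfloor>})"
    by (rule card_mono) (auto simp: coprime_pairs_def le_floor_iff)
  also have "\<dots> = nat \<lfloor>x\<rfloor> ^ 2"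
    by (simp add: power2_eq_square)
  finally have "real (card (coprime_pairs q a u x)) \<le> real (nat \<lfloor>x\<rfloor>) ^ 2"
    by (metis of_nat_le_iff of_nat_power)
  also have "\<dots> \<le> x\<^sup>2"
    by (rule power_mono) (use assms in auto)
  finally show ?thesis .
qed

lemma coprime_of_cong_mult:
  fixes a q u r :: int
  assumes "coprime a q" "[u * r = a] (mod q)"
  shows "coprime u q" "coprime r q"
proof -
  have "coprime (u * r) q"
    using assms by (metis cong_imp_coprime cong_sym)
  then show "coprime u q" "coprime r q"
    by auto
qed

text \<open>As \<open>u\<close> is invertible mod \<open>q\<close>, the solutions form a single
  residue class \<open>c + q * k\<close>, and \<open>k\<close> runs over the integers of an interval
  of length \<open>(x - 1) / q\<close>. Counting these costs an error of at most 1, and replacing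
  \<open>x - 1\<close> by \<open>x\<close> costs at most 1 more.\<close>

lemma card_solutions_upto:
  assumes q: "q \<ge> 1" and u: "coprime u q" and x: "x \<ge> 1"
  shows "\<bar>real (card (solutions_upto q a u x)) - x / of_int q\<bar> \<le> 2"
proof -
  obtain v where v: "[u * v = 1] (mod q)"
    using cong_solve_coprime_int[OF u] by blast
  define c where "c = v * a"
  have cong_c: "[u * m = a] (mod q) \<longleftrightarrow> [m = c] (mod q)" for m
  proof
    assume "[u * m = a] (mod q)"
    then have "[v * (u * m) = v * a] (mod q)"
      by (rule cong_scalar_left)
    moreover have "[u * v * m = 1 * m] (mod q)"
      by (rule cong_scalar_right[OF v])
    ultimately show "[m = c] (mod q)"
      unfolding c_def by (metis cong_sym cong_trans mult.assoc mult.commute mult_1)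
  next
    assume "[m = c] (mod q)"
    then have "[u * m = u * c] (mod q)"
      by (rule cong_scalar_left)
    moreover have "[u * v * a = 1 * a] (mod q)"
      by (rule cong_scalar_right[OF v])
    ultimately show "[u * m = a] (mod q)"
      unfolding c_def by (metis cong_trans mult.assoc mult_1)
  qed
  define lo where "lo = \<lceil>(1 - of_int c) / (of_int q :: real)\<rceil>"
  define hi where "hi = \<lfloor>(x - of_int c) / of_int q\<rfloor>"
  have q0: "(of_int q :: real) \<ge> 1"
    using q by simp
  have range: "1 \<le> c + q * k \<and> of_int (c + q * k) \<le> x \<longleftrightarrow> k \<in> {lo..hi}" for k
  proof -
    have "1 \<le> c + q * k \<longleftrightarrow> (1::real) \<le> of_int (c + q * k)"
      by (simp only: of_int_1_le_iff)
    also have "\<dots> \<longleftrightarrow> lo \<le> k"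
      using q0 by (simp add: lo_def ceiling_le_iff field_simps)
    finally show ?thesis
      using q0 by (simp add: hi_def le_floor_iff field_simps)
  qed
  have "solutions_upto q a u x = (\<lambda>k. c + q * k) ` {lo..hi}"
  proof (intro equalityI subsetI)
    fix m assume m: "m \<in> solutions_upto q a u x"
    then have "[m = c] (mod q)"
      by (simp add: solutions_upto_def cong_c)
    then obtain k where "m = c + q * k"
      by (metis cong_iff_lin cong_sym mult.commute)
    moreover from this have "k \<in> {lo..hi}"
      using m range[of k] by (simp add: solutions_upto_def)
    ultimately show "m \<in> (\<lambda>k. c + q * k) ` {lo..hi}"
      by blast
  next
    fix m assume "m \<in> (\<lambda>k. c + q * k) ` {lo..hi}"
    then obtain k where "k \<in> {lo..hi}" "m = c + q * k"
      by blast
    moreover from this have "[m = c] (mod q)"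
      by (simp add: cong_iff_dvd_diff)
    ultimately show "m \<in> solutions_upto q a u x"
      using range[of k] by (simp add: solutions_upto_def cong_c del: of_int_add of_int_mult)
  qed
  moreover have "inj_on (\<lambda>k. c + q * k) {lo..hi}"
    using q by (auto simp: inj_on_def)
  ultimately have card: "card (solutions_upto q a u x) = nat (hi - lo + 1)"
    by (simp add: card_image)
  have "(x - of_int c) / of_int q - (1 - of_int c) / of_int q = x / of_int q - 1 / (of_int q::real)"
    by (simp add: diff_divide_distrib)
  moreover have "0 \<le> 1 / (of_int q::real)" "1 / (of_int q::real) \<le> 1" "1 / of_int q \<le> x / of_int q"
    using q0 x by (simp_all add: divide_le_eq divide_right_mono)
  moreover have "of_int lo < (1 - of_int c) / (of_int q :: real) + 1"
       "of_int lo \<ge> (1 - of_int c) / (of_int q :: real)"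
       "of_int hi > (x - of_int c) / of_int q - 1"
       "of_int hi \<le> (x - of_int c) / of_int q"
    unfolding lo_def hi_def by linarith+
  \<comment> \<open>The second bound shows that the integer \<open>hi - lo + 1\<close> is
    nonnegative, so the truncation by \<open>nat\<close> in \<open>card\<close> changes
    nothing.\<close>
  ultimately have "\<bar>of_int (hi - lo + 1) - x / of_int q\<bar> \<le> 2" "of_int (hi - lo + 1) > (-1 :: real)"
    unfolding of_int_add of_int_diff of_int_1 by linarith+
  then show ?thesis
    unfolding card by simp
qed

text \<open>Factor the difference of squares as \<open>(S - i) * (S + i)\<close>: the linear count
  bounds the first factor by \<open>2 / x\<close>, hence by 2, and with \<open>i \<le> 1\<close> the
  second is at most 4.\<close>

lemma square_card_solutions_upto:
  assumes q: "q \<ge> 1" and u: "coprime u q" and x: "x \<ge> 1"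
  shows "\<bar>(real (card (solutions_upto q a u x)))\<^sup>2 / x\<^sup>2 - 1 / (of_int q)\<^sup>2\<bar> \<le> 8 / x"
proof -
  define S where "S = real (card (solutions_upto q a u x)) / x"
  define i where "i = 1 / (of_int q :: real)"
  have i: "0 \<le> i" "i \<le> 1"
    using q by (simp_all add: i_def)
  have "\<bar>real (card (solutions_upto q a u x)) - x / of_int q\<bar> / x \<le> 2 / x"
    using card_solutions_upto[OF assms] x by (intro divide_right_mono) auto
  also have "\<bar>real (card (solutions_upto q a u x)) - x / of_int q\<bar> / x
      = \<bar>(real (card (solutions_upto q a u x)) - x / of_int q) / x\<bar>"
    using x by simp
  also have "(real (card (solutions_upto q a u x)) - x / of_int q) / x = S - i"
    using x by (simp add: S_def i_def diff_divide_distrib)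
  finally have 1: "\<bar>S - i\<bar> \<le> 2 / x" .
  have "2 / x \<le> 2"
    using x by (simp add: divide_le_eq)
  then have 2: "\<bar>S + i\<bar> \<le> 4"
    using 1 i by linarith
  have "(real (card (solutions_upto q a u x)))\<^sup>2 / x\<^sup>2 - 1 / (of_int q)\<^sup>2 = (S - i) * (S + i)"
    by (simp add: S_def i_def power2_eq_square algebra_simps)
  also have "\<bar>\<dots>\<bar> \<le> 2 / x * 4"
    unfolding abs_mult using 1 2 x by (intro mult_mono) auto
  finally show ?thesis
    by simp
qed

section \<open>Sorting pairs of solutions by their gcd\<close>

text \<open>A pair of solutions is \<open>(g * r, g * s)\<close> for exactly one \<open>g\<close>
  and coprime \<open>r\<close>, \<open>s\<close>, with \<open>g\<close> the gcd. The factor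
  \<open>g\<close> moves over to the multiplier, and it is coprime to \<open>q\<close> because every
  solution is, \<open>a\<close> being so.\<close>

lemma square_card_solutions_upto_eq_sum:
  assumes aq: "coprime a q"
  shows "(card (solutions_upto q a u x))\<^sup>2 =
    (\<Sum>g | 1 \<le> g \<and> of_int g \<le> x \<and> coprime g q. card (coprime_pairs q a (u * g) (x / of_int g)))"
proof -
  define G where "G = {g::int. 1 \<le> g \<and> of_int g \<le> x \<and> coprime g q}"
  define B where "B = Sigma G (\<lambda>g. coprime_pairs q a (u * g) (x / of_int g))"
  define h where "h = (\<lambda>(g::int, r::int, s::int). (g * r, g * s))"
  have "finite G"
    by (rule finite_subset[of _ "{1..\<lfloor>x\<rfloor>}"]) (auto simp: G_def le_floor_iff)
  have "inj_on h B"
  proof (rule inj_onI)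
    fix y z assume yz: "y \<in> B" "z \<in> B" "h y = h z"
    obtain g r s where y: "y = (g, r, s)" by (cases y)
    obtain g' r' s' where z: "z = (g', r', s')" by (cases z)
    have pos: "g \<ge> 1" "g' \<ge> 1" and cop: "coprime r s" "coprime r' s'"
      using yz by (auto simp: y z B_def G_def coprime_pairs_def)
    have eq: "g * r = g' * r'" "g * s = g' * s'"
      using yz by (auto simp: h_def y z)
    have "gcd (g * r) (g * s) = g" "gcd (g' * r') (g' * s') = g'"
      using pos cop by (simp_all add: gcd_mult_distrib_int[symmetric])
    then have "g = g'"
      using eq by simp
    then show "y = z"
      using eq pos by (simp add: y z)
  qed
  moreover have "h ` B = solutions_upto q a u x \<times> solutions_upto q a u x"
  proof (intro equalityI subsetI)
    fix z assume "z \<in> h ` B"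
    then obtain g r s where z: "z = (g * r, g * s)" "g \<in> G"
        "(r, s) \<in> coprime_pairs q a (u * g) (x / of_int g)"
      by (auto simp: B_def h_def)
    then have "0 < g * r" "0 < g * s"
      by (auto simp: G_def coprime_pairs_def intro!: mult_pos_pos)
    then have "1 \<le> g * r" "1 \<le> g * s"
      by linarith+
    with z show "z \<in> solutions_upto q a u x \<times> solutions_upto q a u x"
      by (auto simp: G_def coprime_pairs_def solutions_upto_def field_simps)
  next
    fix z assume z: "z \<in> solutions_upto q a u x \<times> solutions_upto q a u x"
    then obtain m n where mn: "z = (m, n)" "m \<in> solutions_upto q a u x" "n \<in> solutions_upto q a u x"
      by auto
    define g where "g = gcd m n"
    have "m \<ge> 1" "n \<ge> 1"
      using mn by (auto simp: solutions_upto_def)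
    then have g: "g \<ge> 1"
      by (simp add: g_def int_one_le_iff_zero_less)
    obtain r s where rs: "m = g * r" "n = g * s" "coprime r s"
      using gcd_coprime_exists[of m n] g unfolding g_def
      by (metis mult.commute not_one_le_zero)
    have "r \<ge> 1" "s \<ge> 1"
      using rs g \<open>m \<ge> 1\<close> \<open>n \<ge> 1\<close>
      by (metis int_one_le_iff_zero_less zero_less_mult_pos)+
    moreover have "g \<le> m"
      using g \<open>m \<ge> 1\<close> by (simp add: g_def zdvd_imp_le)
    moreover have "coprime m q"
      using mn aq by (auto simp: solutions_upto_def dest: coprime_of_cong_mult)
    then have "coprime g q"
      by (simp add: rs)
    moreover have "of_int m \<le> x"
      using mn by (simp add: solutions_upto_def)
    then have "of_int g \<le> x"
      using \<open>g \<le> m\<close> by linarith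
    ultimately have "(g, r, s) \<in> B"
      using mn rs g by (auto simp: B_def G_def coprime_pairs_def solutions_upto_def field_simps)
    then show "z \<in> h ` B"
      by (force simp: mn rs h_def)
  qed
  ultimately have "card B = card (solutions_upto q a u x \<times> solutions_upto q a u x)"
    by (metis card_image)
  also have "\<dots> = (card (solutions_upto q a u x))\<^sup>2"
    by (simp add: card_cartesian_product power2_eq_square)
  also have "card B = (\<Sum>g\<in>G. card (coprime_pairs q a (u * g) (x / of_int g)))"
    unfolding B_def using \<open>finite G\<close> by (intro card_SigmaI) auto
  finally show ?thesis
    unfolding G_def ..
qed

section \<open>The sum of inverse squares over integers coprime to \<open>q\<close>\<close>

lemma has_sum_inverse_squares_int:
  "((\<lambda>g::int. 1 / (of_int g)\<^sup>2) has_sum (pi\<^sup>2 / 6)) {1..}"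
proof -
  have "((\<lambda>n::nat. 1 / real (Suc n) ^ 2) has_sum (pi\<^sup>2 / 6)) UNIV"
    using inverse_squares_sums by (intro norm_summable_imp_has_sum) (auto simp: sums_iff)
  moreover have "bij_betw (\<lambda>n::nat. int n + 1) UNIV {1..}"
    by (rule bij_betw_byWitness[where f' = "\<lambda>g. nat (g - 1)"]) auto
  ultimately show ?thesis
    by (subst has_sum_reindex_bij_betw[symmetric]) (auto simp: add.commute)
qed

text \<open>Sieve by one prime at a time. Since no prime of \<open>F\<close> divides a new prime
  \<open>p\<close>, the multiples of \<open>p\<close> in the sieved set are exactly \<open>p\<close>
  times that set; they carry the fraction \<open>1 / p ^ 2\<close> of the sum, and removing them
  contributes the factor \<open>1 - 1 / p ^ 2\<close>.\<close>

lemma has_sum_inverse_squares_sieve: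
  fixes F :: "int set"
  assumes "finite F" "\<And>p. p \<in> F \<Longrightarrow> prime p"
  shows "((\<lambda>g::int. 1 / (of_int g)\<^sup>2) has_sum (pi\<^sup>2 / 6 * (\<Prod>p\<in>F. 1 - 1 / (of_int p)\<^sup>2)))
    {g. 1 \<le> g \<and> (\<forall>p\<in>F. \<not> p dvd g)}"
  using assms
proof (induction F)
  case empty
  then show ?case
    using has_sum_inverse_squares_int by (simp add: atLeast_def)
next
  case (insert p F)
  define A where "A = {g::int. 1 \<le> g \<and> (\<forall>p\<in>F. \<not> p dvd g)}"
  define c where "c = pi\<^sup>2 / 6 * (\<Prod>p\<in>F. 1 - 1 / (of_int p)\<^sup>2)"
  have IH: "((\<lambda>g::int. 1 / (of_int g)\<^sup>2) has_sum c) A"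
    unfolding A_def c_def using insert by auto
  have p: "prime p" "p > 1"
    using insert.prems[of p] by (auto simp: prime_gt_1_int)
  have ndvd: "\<not> p' dvd p" if "p' \<in> F" for p'
    using that insert p primes_dvd_imp_eq by blast
  have img: "(*) p ` A = {g\<in>A. p dvd g}"
  proof (intro equalityI subsetI)
    fix g assume "g \<in> (*) p ` A"
    then obtain h where h: "g = p * h" "h \<in> A" by blast
    have "0 < p * h"
      using h p by (intro mult_pos_pos) (auto simp: A_def)
    moreover have "\<not> p' dvd p * h" if "p' \<in> F" for p'
      using that h insert.prems ndvd by (auto simp: A_def prime_dvd_mult_iff)
    ultimately show "g \<in> {g\<in>A. p dvd g}"
      using h by (auto simp: A_def)
  next
    fix g assume g: "g \<in> {g\<in>A. p dvd g}"
    then obtain h where h: "g = p * h" by auto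
    have "0 < h"
      using g h p by (metis (no_types, lifting) A_def int_one_le_iff_zero_less mem_Collect_eq
          order_less_trans zero_less_mult_pos zero_less_one)
    then have "h \<in> A"
      using g h by (auto simp: A_def)
    then show "g \<in> (*) p ` A"
      using h by blast
  qed
  have "((\<lambda>g::int. 1 / (of_int p)\<^sup>2 * (1 / (of_int g)\<^sup>2)) has_sum (1 / (of_int p)\<^sup>2 * c)) A"
    by (rule has_sum_cmult_right[OF IH])
  also have "(\<lambda>g::int. 1 / (of_int p)\<^sup>2 * (1 / (of_int g)\<^sup>2)) = (\<lambda>g::int. 1 / (of_int g :: real)\<^sup>2) \<circ> (*) p"
    by (auto simp: power_mult_distrib)
  finally have "((\<lambda>g::int. 1 / (of_int g)\<^sup>2) has_sum (1 / (of_int p)\<^sup>2 * c)) {g\<in>A. p dvd g}"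
    unfolding img[symmetric] using p by (subst has_sum_reindex) (auto simp: inj_on_def comp_def)
  from has_sum_Diff[OF IH this]
  have "((\<lambda>g::int. 1 / (of_int g)\<^sup>2) has_sum (c - 1 / (of_int p)\<^sup>2 * c)) (A - {g\<in>A. p dvd g})"
    by auto
  moreover have "A - {g\<in>A. p dvd g} = {g. 1 \<le> g \<and> (\<forall>p\<in>insert p F. \<not> p dvd g)}"
    by (auto simp: A_def)
  moreover have "c - 1 / (of_int p)\<^sup>2 * c = pi\<^sup>2 / 6 * (\<Prod>p\<in>insert p F. 1 - 1 / (of_int p)\<^sup>2)"
    using insert by (simp add: c_def algebra_simps)
  ultimately show ?case
    by (simp only:)
qed

text \<open>This is zeta(2) with the Euler factors at the primes dividing \<open>q\<close> removed,
  the Z of the overview.\<close>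

definition coprime_zeta2 :: "int \<Rightarrow> real"
  where "coprime_zeta2 q = pi\<^sup>2 / 6 * (\<Prod>p | prime p \<and> p dvd q. 1 - 1 / (of_int p)\<^sup>2)"

lemma finite_prime_divisors_int:
  fixes q :: int
  assumes "q \<noteq> 0"
  shows "finite {p. prime p \<and> p dvd q}"
  by (rule finite_subset[OF _ finite_divisors_int[OF assms]]) auto

lemma has_sum_coprime_zeta2:
  assumes "q \<noteq> 0"
  shows "((\<lambda>g::int. 1 / (of_int g)\<^sup>2) has_sum coprime_zeta2 q) {g. 1 \<le> g \<and> coprime g q}"
proof -
  have "coprime g q \<longleftrightarrow> (\<forall>p\<in>{p. prime p \<and> p dvd q}. \<not> p dvd g)" if "g \<ge> 1" for g
  proof
    assume "coprime g q"
    then show "\<forall>p\<in>{p. prime p \<and> p dvd q}. \<not> p dvd g"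
      using coprime_common_divisor not_prime_unit by blast
  next
    assume "\<forall>p\<in>{p. prime p \<and> p dvd q}. \<not> p dvd g"
    then show "coprime g q"
      using that by (intro coprimeI) (metis assms dvd_trans mem_Collect_eq not_one_le_zero prime_divisor_exists dvd_0_left)
  qed
  then have "{g. 1 \<le> g \<and> coprime g q} = {g. 1 \<le> g \<and> (\<forall>p\<in>{p. prime p \<and> p dvd q}. \<not> p dvd g)}"
    by blast
  then show ?thesis
    unfolding coprime_zeta2_def
    using has_sum_inverse_squares_sieve[OF finite_prime_divisors_int[OF assms]] by simp
qed

text \<open>Compare the sum over \<open>g\<close> coprime to \<open>q\<close> with its term at
  \<open>g = 1\<close> and with the full sum over all positive \<open>g\<close>. The strict bound by
  2 makes \<open>Z - 1\<close> a contraction factor.\<close>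

lemma coprime_zeta2_bounds:
  assumes "q \<noteq> 0"
  shows "1 \<le> coprime_zeta2 q" "coprime_zeta2 q < 2"
proof -
  have "((\<lambda>g::int. 1 / (of_int g)\<^sup>2) has_sum (1::real)) {1::int}"
    by (rule has_sum_finiteI) simp_all
  then show "1 \<le> coprime_zeta2 q"
    by (rule has_sum_mono2[OF _ has_sum_coprime_zeta2[OF assms]]) auto
  have "coprime_zeta2 q \<le> pi\<^sup>2 / 6"
    by (rule has_sum_mono2[OF has_sum_coprime_zeta2[OF assms] has_sum_inverse_squares_int]) auto
  also have "pi < 3.2"
    using pi_approx by simp
  then have "pi\<^sup>2 < 3.2\<^sup>2"
    by (intro power_strict_mono) auto
  then have "pi\<^sup>2 / 6 < 2"
    by (simp add: power2_eq_square)
  finally show "coprime_zeta2 q < 2" .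
qed

lemma ratio_const_eq:
  "ratio_const q = (\<Sum>t | 1 \<le> t \<and> t \<le> q \<and> coprime t q. 1 / of_int t ^ 2) / coprime_zeta2 q"
proof -
  have "(\<Prod>p | prime p \<and> p dvd q. inverse (1 - 1 / of_int p ^ 2))
      = inverse (\<Prod>p | prime p \<and> p dvd q. 1 - 1 / (of_int p :: real) ^ 2)"
    by (rule prod_inversef[unfolded comp_def])
  then show ?thesis
    unfolding ratio_const_def coprime_zeta2_def by (simp add: field_simps)
qed

section \<open>The limiting density of coprime pairs\<close>

definition pair_density :: "int \<Rightarrow> int \<Rightarrow> int \<Rightarrow> real \<Rightarrow> real"
  where "pair_density q a u x = real (card (coprime_pairs q a u x)) / x\<^sup>2"

text \<open>The only possible common limit K for all units: dividing the gcd identity by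
  \<open>x ^ 2\<close> and letting \<open>x\<close> grow forces
  \<open>1 / q ^ 2 = K * Z\<close>.\<close>

definition limit_density :: "int \<Rightarrow> real"
  where "limit_density q = 1 / ((of_int q)\<^sup>2 * coprime_zeta2 q)"

lemma pair_density_bounds:
  assumes "x \<ge> 0"
  shows "0 \<le> pair_density q a u x" "pair_density q a u x \<le> 1"
  using card_coprime_pairs_le[OF assms, of q a u]
  by (auto simp: pair_density_def divide_le_eq)

lemma limit_density_bounds:
  assumes "q \<ge> 1"
  shows "0 < limit_density q" "limit_density q \<le> 1"
proof -
  have Z: "1 \<le> coprime_zeta2 q"
    using coprime_zeta2_bounds assms by auto
  have "1 \<le> (of_int q :: real)\<^sup>2"
    using assms by (simp add: one_le_power)
  then have "1 * 1 \<le> (of_int q)\<^sup>2 * coprime_zeta2 q"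
    using Z by (intro mult_mono) auto
  then show "0 < limit_density q" "limit_density q \<le> 1"
    by (auto simp: limit_density_def divide_le_eq)
qed

text \<open>Source of the weights \<open>1 / g ^ 2\<close> and \<open>1 / t ^ 2\<close>. At
  \<open>x = 0\<close> both sides are 0 by the convention for division by zero.\<close>

lemma pair_density_scale:
  assumes "t \<ge> 1"
  shows "real (card (coprime_pairs q a u (x / of_int t))) / x\<^sup>2
    = 1 / (of_int t)\<^sup>2 * pair_density q a u (x / of_int t)"
  using assms by (simp add: pair_density_def power_divide)

text \<open>Solve the gcd identity for its term \<open>g = 1\<close>. The other \<open>g\<close> in
  a finite set \<open>F\<close> contribute at most \<open>(Z - 1) * c\<close>, because the assumed
  bound is uniform in the unit and so applies to \<open>u * g\<close>; outside \<open>F\<close> the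
  trivial bound 1 on the density and a small tail of weights suffice.\<close>

lemma pair_density_error_step:
  assumes q: "q \<ge> 1" and aq: "coprime a q" and c: "c \<ge> 0" and e: "e > 0"
    and bound: "\<And>x u. x \<ge> X \<Longrightarrow> coprime u q \<Longrightarrow> \<bar>pair_density q a u x - limit_density q\<bar> \<le> c"
  shows "\<exists>Y. \<forall>x\<ge>Y. \<forall>u. coprime u q \<longrightarrow>
    \<bar>pair_density q a u x - limit_density q\<bar> \<le> (coprime_zeta2 q - 1) * c + e"
proof -
  define Z where "Z = coprime_zeta2 q"
  define K where "K = limit_density q"
  define w where "w = (\<lambda>g::int. 1 / (of_int g :: real)\<^sup>2)"
  define A where "A = {g::int. 1 \<le> g \<and> coprime g q}"
  have Z: "(w has_sum Z) A" "1 \<le> Z"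
    using has_sum_coprime_zeta2[of q] coprime_zeta2_bounds[of q] q by (auto simp: w_def Z_def A_def)
  have K: "0 \<le> K" "K \<le> 1" and KZ: "1 / (of_int q)\<^sup>2 = K * Z"
    using limit_density_bounds[OF q] Z by (auto simp: K_def limit_density_def Z_def)
  have w: "w g \<ge> 0" for g
    by (simp add: w_def)
  have "w 1 = 1"
    by (simp add: w_def)
  have sum_le: "sum w B \<le> Z" if "finite B" "B \<subseteq> A" for B
    by (rule has_sum_mono2[OF has_sum_finite[OF that(1)] Z(1)]) (use that w in auto)
  \<comment> \<open>Finiteness matters: one threshold on \<open>x\<close> must put
    \<open>x / g\<close> beyond \<open>X\<close> for every \<open>g\<close> in the set.\<close>
  obtain F0 where F0: "finite F0" "F0 \<subseteq> A" "dist (sum w F0) Z \<le> e / 2"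
    using has_sum_finite_approximation[OF Z(1), of "e / 2"] e by auto
  define F where "F = insert 1 F0"
  have F: "finite F" "F \<subseteq> A" "1 \<in> F" "F \<noteq> {}"
    using F0 by (auto simp: F_def A_def)
  have "sum w F0 \<le> sum w F"
    by (rule sum_mono2) (use F0 w in \<open>auto simp: F_def\<close>)
  then have T: "Z - e / 2 \<le> sum w F" "sum w F \<le> Z"
    using F0(3) sum_le[OF F(1,2)] by (auto simp: dist_real_def)
  \<comment> \<open>The summands ensure in turn \<open>x \<ge> 1\<close>, then
    \<open>8 / x \<le> e / 2\<close>, and finally \<open>X \<le> x / g\<close> together with
    \<open>g \<le> x\<close> for all \<open>g\<close> in \<open>F\<close>.\<close>
  define Y where "Y = 1 + 16 / e + of_int (Max F) * max X 1"
  have M: "1 \<le> Max F"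
    using F by (intro Max_ge) auto
  have "\<bar>pair_density q a u x - K\<bar> \<le> (Z - 1) * c + e" if x: "x \<ge> Y" and u: "coprime u q" for x u
  proof -
    define p where "p = (\<lambda>g. pair_density q a (u * g) (x / of_int g))"
    define s where "s = (real (card (solutions_upto q a u x)))\<^sup>2 / x\<^sup>2"
    define G where "G = {g::int. 1 \<le> g \<and> of_int g \<le> x \<and> coprime g q}"
    have M1: "of_int (Max F) * max X 1 \<ge> of_int (Max F) * 1"
      using M by (intro mult_left_mono) auto
    have x1: "x \<ge> 1" and xe: "x \<ge> 16 / e" and xM: "x \<ge> of_int (Max F) * max X 1"
      using x M M1 e by (auto simp: Y_def intro: order_trans[rotated] add_nonneg_nonneg)
    have p01: "0 \<le> p g" "p g \<le> 1" if "g \<ge> 1" for g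
      using pair_density_bounds[of "x / of_int g"] that x1 by (auto simp: p_def)
    have large: "X \<le> x / of_int g" "of_int g \<le> x" if "g \<in> F" for g
    proof -
      have g: "1 \<le> g" "g \<le> Max F"
        using that F by (auto simp: A_def)
      then have "of_int g * max X 1 \<le> of_int (Max F) * max X 1"
        by (intro mult_right_mono) auto
      moreover have "of_int g * X \<le> of_int g * max X 1" "of_int g * 1 \<le> of_int g * max X 1"
        using g by (auto intro!: mult_left_mono)
      ultimately have *: "of_int g * X \<le> x" "of_int g \<le> x"
        using xM by linarith+
      then show "X \<le> x / of_int g" "of_int g \<le> x"
        using g * by (simp_all add: le_divide_eq mult.commute)
    qed
    have G: "finite G" "G \<subseteq> A" "F \<subseteq> G"
      by (rule finite_subset[of _ "{1..\<lfloor>x\<rfloor>}"]) (use F large in \<open>auto simp: G_def A_def le_floor_iff\<close>)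
    have "s = (\<Sum>g\<in>G. real (card (coprime_pairs q a (u * g) (x / of_int g))) / x\<^sup>2)"
      unfolding s_def G_def
      by (simp add: square_card_solutions_upto_eq_sum[OF aq] sum_divide_distrib flip: of_nat_power)
    also have "\<dots> = (\<Sum>g\<in>G. w g * p g)"
      by (intro sum.cong) (auto simp: pair_density_scale w_def p_def G_def)
    also have "\<dots> = (\<Sum>g\<in>G - F. w g * p g) + (\<Sum>g\<in>F. w g * p g)"
      by (rule sum.subset_diff[OF G(3,1)])
    also have "(\<Sum>g\<in>F. w g * p g) = p 1 + (\<Sum>g\<in>F - {1}. w g * p g)"
      using F \<open>w 1 = 1\<close> by (simp add: sum.remove)
    finally have s: "s = (\<Sum>g\<in>G - F. w g * p g) + p 1 + (\<Sum>g\<in>F - {1}. w g * p g)"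
      by simp
    have "\<bar>s - K * Z\<bar> \<le> 8 / x"
      using square_card_solutions_upto[OF q u x1] by (simp add: s_def KZ)
    also have "8 / x \<le> e / 2"
      using xe x1 e by (simp add: field_simps)
    finally have 1: "\<bar>s - K * Z\<bar> \<le> e / 2" .
    have "(\<Sum>g\<in>G - F. w g * p g) \<le> (\<Sum>g\<in>G - F. w g)"
      using p01 w by (intro sum_mono mult_left_le) (auto simp: G_def)
    also have "\<dots> = sum w G - sum w F"
      using G by (intro sum_diff) auto
    also have "\<dots> \<le> e / 2"
      using sum_le[OF G(1,2)] T by simp
    finally have 2: "(\<Sum>g\<in>G - F. w g * p g) \<le> e / 2" .
    have 3: "0 \<le> (\<Sum>g\<in>G - F. w g * p g)"
      using p01 w by (intro sum_nonneg) (auto simp: G_def)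
    have T1: "sum w (F - {1}) = sum w F - 1"
      using F \<open>w 1 = 1\<close> by (simp add: sum.remove)
    have "\<bar>(\<Sum>g\<in>F - {1}. w g * p g) - K * (sum w F - 1)\<bar> = \<bar>\<Sum>g\<in>F - {1}. w g * (p g - K)\<bar>"
      by (simp add: T1[symmetric] sum_distrib_left right_diff_distrib sum_subtractf mult.commute)
    also have "\<dots> \<le> (\<Sum>g\<in>F - {1}. \<bar>w g * (p g - K)\<bar>)"
      by (rule sum_abs)
    also have "\<dots> \<le> (\<Sum>g\<in>F - {1}. w g * c)"
    proof (rule sum_mono)
      fix g assume "g \<in> F - {1}"
      then have "coprime (u * g) q" "X \<le> x / of_int g"
        using u F large by (auto simp: A_def)
      then show "\<bar>w g * (p g - K)\<bar> \<le> w g * c"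
        using bound w by (auto simp: abs_mult p_def K_def intro!: mult_left_mono)
    qed
    also have "\<dots> = (sum w F - 1) * c"
      by (simp add: T1[symmetric] sum_distrib_right)
    also have "\<dots> \<le> (Z - 1) * c"
      using T c by (intro mult_right_mono) auto
    finally have 4: "\<bar>(\<Sum>g\<in>F - {1}. w g * p g) - K * (sum w F - 1)\<bar> \<le> (Z - 1) * c" .
    have 5: "0 \<le> K * (Z - sum w F)"
      using K T by simp
    have "K * (Z - sum w F) \<le> 1 * (e / 2)"
      using K T e by (intro mult_mono) auto
    then have 6: "K * (Z - sum w F) \<le> e / 2"
      by simp
    \<comment> \<open>The first difference costs \<open>e / 2\<close>, the second
      \<open>(Z - 1) * c\<close>. The last bracket is a difference of two numbers in the interval
      from 0 to \<open>e / 2\<close>, so it costs only \<open>e / 2\<close>.\<close>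
    have "p 1 - K = (s - K * Z) - ((\<Sum>g\<in>F - {1}. w g * p g) - K * (sum w F - 1))
        + (K * (Z - sum w F) - (\<Sum>g\<in>G - F. w g * p g))"
      by (simp add: s algebra_simps)
    then have "\<bar>p 1 - K\<bar> \<le> (Z - 1) * c + e"
      using 1 2 3 4 5 6 by linarith
    then show ?thesis
      by (simp add: p_def)
  qed
  then show ?thesis
    unfolding Z_def K_def by blast
qed

text \<open>Iterate the error step from the trivial bound 1. Each round multiplies the uniform error
  by \<open>Z / 2\<close>, the midpoint of \<open>Z - 1\<close> and 1, which is below 1.\<close>

lemma pair_density_tendsto:
  assumes q: "q \<ge> 1" and aq: "coprime a q" and u: "coprime u q"
  shows "(pair_density q a u \<longlongrightarrow> limit_density q) at_top"
proof -
  define Z where "Z = coprime_zeta2 q"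
  have Z: "1 \<le> Z" "Z < 2"
    using coprime_zeta2_bounds[of q] q by (auto simp: Z_def)
  have geom: "\<exists>Y. \<forall>x\<ge>Y. \<forall>u. coprime u q \<longrightarrow>
    \<bar>pair_density q a u x - limit_density q\<bar> \<le> (Z / 2) ^ n" for n
  proof (induction n)
    case 0
    have "\<bar>pair_density q a u x - limit_density q\<bar> \<le> 1" if "x \<ge> 0" for x u
      using pair_density_bounds[OF that, of q a u] limit_density_bounds[OF q] by linarith
    then show ?case
      by auto
  next
    case (Suc n)
    define c where "c = (Z / 2) ^ n"
    have c: "c > 0"
      using Z by (simp add: c_def)
    obtain X where "\<And>x u. x \<ge> X \<Longrightarrow> coprime u q \<Longrightarrow> \<bar>pair_density q a u x - limit_density q\<bar> \<le> c"
      using Suc unfolding c_def by blast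
    \<comment> \<open>The slack is positive because \<open>Z < 2\<close>, and it is chosen so that
      \<open>(Z - 1) * c\<close> plus the slack equals \<open>Z / 2 * c\<close>.\<close>
    from pair_density_error_step[OF q aq _ _ this, of "(1 - Z / 2) * c"]
    have "\<exists>Y. \<forall>x\<ge>Y. \<forall>u. coprime u q \<longrightarrow>
        \<bar>pair_density q a u x - limit_density q\<bar> \<le> (Z - 1) * c + (1 - Z / 2) * c"
      using c Z by (simp add: Z_def)
    moreover have "(Z - 1) * c + (1 - Z / 2) * c = (Z / 2) ^ Suc n"
      by (simp add: c_def algebra_simps)
    ultimately show ?case
      by (simp only:)
  qed
  show ?thesis
  proof (rule tendstoI)
    fix e :: real assume "e > 0"
    then obtain n where n: "(Z / 2) ^ n < e"
      using real_arch_pow_inv[of e "Z / 2"] Z by auto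
    obtain Y where "\<And>x. x \<ge> Y \<Longrightarrow> \<bar>pair_density q a u x - limit_density q\<bar> \<le> (Z / 2) ^ n"
      using geom[of n] u by blast
    then have "\<forall>x\<ge>Y. dist (pair_density q a u x) (limit_density q) < e"
      using n by (auto simp: dist_real_def intro: le_less_trans)
    then show "\<forall>\<^sub>F x in at_top. dist (pair_density q a u x) (limit_density q) < e"
      by (auto simp: eventually_at_top_linorder)
  qed
qed

section \<open>Decomposing the ratio set by reduced fractions\<close>

lemma coprime_fraction_unique:
  fixes r s r' s' :: int
  assumes "coprime r s" "coprime r' s'" "s \<ge> 1" "s' \<ge> 1"
    and "of_int r / of_int s = (of_int r' / of_int s' :: rat)"
  shows "r = r' \<and> s = s'"
proof -
  have "Fract r s = Fract r' s'"
    using assms by (simp add: Fract_of_int_quotient)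
  then have "quotient_of (Fract r s) = quotient_of (Fract r' s')"
    by simp
  then show ?thesis
    using assms by (simp add: quotient_of_Fract normalize_stable)
qed

text \<open>Cancel the gcd \<open>g\<close> of numerator and denominator, then replace
  \<open>g\<close> by its representative \<open>t\<close> in \<open>{1..q}\<close>: the congruences
  persist and, as \<open>t \<le> g\<close>, the size bounds do too. Distinct \<open>t\<close> give
  disjoint sets of reduced pairs.\<close>

lemma card_ratio_set_ap_upto:
  assumes q: "q \<ge> 1" and aq: "coprime a q"
  shows "card (ratio_set (ap_upto q a n)) =
    (\<Sum>t | 1 \<le> t \<and> t \<le> q \<and> coprime t q. card (coprime_pairs q a t (real n / of_int t)))"
proof -
  define U where "U = {t. 1 \<le> t \<and> t \<le> q \<and> coprime t q}"
  define P where "P = (\<lambda>t. coprime_pairs q a t (real n / of_int t))"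
  define f where "f = (\<lambda>(r, s). of_int r / of_int s :: rat)"
  have "finite U"
    by (rule finite_subset[of _ "{1..q}"]) (auto simp: U_def)
  have disj: "P t \<inter> P t' = {}" if "t \<in> U" "t' \<in> U" "t \<noteq> t'" for t t'
  proof (rule ccontr)
    assume "P t \<inter> P t' \<noteq> {}"
    then obtain r where r: "[t * r = a] (mod q)" "[t' * r = a] (mod q)"
      by (auto simp: P_def coprime_pairs_def)
    then have "[t * r = t' * r] (mod q)"
      by (metis cong_sym cong_trans)
    \<comment> \<open>\<open>r\<close> is a unit mod \<open>q\<close>, so it cancels; two elements
      of \<open>{1..q}\<close> congruent mod \<open>q\<close> are then equal.\<close>
    then have "[t = t'] (mod q)"
      using coprime_of_cong_mult(2)[OF aq r(1)] by (simp add: cong_mult_rcancel)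
    then have "q dvd (t - t')"
      by (simp add: cong_iff_dvd_diff)
    moreover have "\<bar>t - t'\<bar> < q"
      using that by (auto simp: U_def)
    ultimately show False
      using dvd_imp_le_int[of "t - t'" q] that by simp
  qed
  have inj: "inj_on f (\<Union>t\<in>U. P t)"
    by (rule inj_onI)
       (auto simp: f_def P_def coprime_pairs_def dest: coprime_fraction_unique)
  have "ratio_set (ap_upto q a n) = f ` (\<Union>t\<in>U. P t)"
  proof (intro equalityI subsetI)
    fix z assume "z \<in> ratio_set (ap_upto q a n)"
    then obtain x y where xy: "z = of_int x / of_int y" "1 \<le> x" "x \<le> int n" "[x = a] (mod q)"
        "1 \<le> y" "y \<le> int n" "[y = a] (mod q)"
      by (auto simp: ratio_set_def ap_upto_def)
    define g where "g = gcd x y"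
    have g: "g \<ge> 1"
      using xy by (simp add: g_def int_one_le_iff_zero_less)
    obtain r s where rs: "x = g * r" "y = g * s" "coprime r s"
      using gcd_coprime_exists[of x y] g unfolding g_def
      by (metis mult.commute not_one_le_zero)
    have pos: "r \<ge> 1" "s \<ge> 1"
      using rs g xy by (metis int_one_le_iff_zero_less zero_less_mult_pos)+
    \<comment> \<open>Shifting by one puts the residue in \<open>{1..q}\<close> instead of
      \<open>{0..q - 1}\<close>, so \<open>t\<close> is positive even for
      \<open>q = 1\<close>.\<close>
    define t where "t = (g - 1) mod q + 1"
    have t: "1 \<le> t" "t \<le> q"
      using q by (auto simp: t_def add1_zle_eq)
    have tg: "[t = g] (mod q)"
      using cong_add[of "(g - 1) mod q" "g - 1" q 1 1] by (simp add: t_def)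
    have "(g - 1) mod q \<le> g - 1"
      using g q by (intro zmod_le_nonneg_dividend) auto
    then have "t \<le> g"
      by (simp add: t_def)
    have tr: "[t * r = a] (mod q)" "[t * s = a] (mod q)"
      using cong_scalar_right[OF tg] xy rs by (blast intro: cong_trans)+
    have "t * r \<le> int n" "t * s \<le> int n"
      using \<open>t \<le> g\<close> pos xy rs by (meson mult_right_mono order_trans zero_le_one)+
    then have "real_of_int (t * r) \<le> real n" "real_of_int (t * s) \<le> real n"
      by linarith+
    then have "(r, s) \<in> P t"
      using t pos rs tr by (simp add: P_def coprime_pairs_def le_divide_eq mult.commute)
    moreover have "t \<in> U"
      using t coprime_of_cong_mult(1)[OF aq tr(1)] by (simp add: U_def)
    moreover have "z = f (r, s)"
      using xy g rs by (simp add: f_def)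
    ultimately show "z \<in> f ` (\<Union>t\<in>U. P t)"
      by blast
  next
    fix z assume "z \<in> f ` (\<Union>t\<in>U. P t)"
    then obtain t r s where z: "z = f (r, s)" "t \<in> U" "(r, s) \<in> P t"
      by auto
    then have t: "t \<ge> 1" and rs: "r \<ge> 1" "s \<ge> 1"
      by (auto simp: U_def P_def coprime_pairs_def)
    have "0 < t * r" "0 < t * s"
      using t rs by simp_all
    moreover have "real_of_int (t * r) \<le> real n" "real_of_int (t * s) \<le> real n"
      using z t by (simp_all add: P_def coprime_pairs_def le_divide_eq mult.commute)
    then have "t * r \<le> int n" "t * s \<le> int n"
      by linarith+
    ultimately have "t * r \<in> ap_upto q a n" "t * s \<in> ap_upto q a n"
      using z by (auto simp: ap_upto_def P_def coprime_pairs_def)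
    moreover have "z = of_int (t * r) / of_int (t * s)"
      using t z by (simp add: f_def)
    ultimately show "z \<in> ratio_set (ap_upto q a n)"
      unfolding ratio_set_def by blast
  qed
  then have "card (ratio_set (ap_upto q a n)) = card (\<Union>t\<in>U. P t)"
    using inj by (simp add: card_image)
  also have "\<dots> = (\<Sum>t\<in>U. card (P t))"
    by (rule card_UN_disjoint) (use \<open>finite U\<close> disj in \<open>auto simp: P_def\<close>)
  finally show ?thesis
    by (simp add: U_def P_def)
qed

section \<open>Asymptotics of the ratio set\<close>

theorem theorem1p3:
  fixes q a :: int
  assumes "q \<ge> 1"
    and "coprime a q"
  shows "(\<lambda>n::nat. real (card (ratio_set (ap_upto q a n))))
           \<sim>[sequentially] (\<lambda>n. ratio_const q * (real n ^ 2 / real_of_int q ^ 2))"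
proof -
  define U where "U = {t. 1 \<le> t \<and> t \<le> q \<and> coprime t q}"
  \<comment> \<open>\<open>W\<close> is the limit of the cardinality divided by
    \<open>n ^ 2\<close>, obtained termwise from the finite sum over \<open>t\<close>, since each
    \<open>n / t\<close> tends to infinity.\<close>
  define W where "W = (\<Sum>t\<in>U. 1 / (of_int t)\<^sup>2 * limit_density q)"
  have "finite U"
    by (rule finite_subset[of _ "{1..q}"]) (auto simp: U_def)
  have W: "W = ratio_const q / (of_int q)\<^sup>2"
    by (simp add: W_def U_def ratio_const_eq limit_density_def sum_divide_distrib mult_ac)
  have "W > 0"
    unfolding W_def
  proof (rule sum_pos)
    show "finite U" by fact
    show "U \<noteq> {}"
      using assms(1) by (auto simp: U_def intro: exI[of _ 1])
    show "0 < 1 / (of_int t)\<^sup>2 * limit_density q" if "t \<in> U" for t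
      using that limit_density_bounds[OF assms(1)] by (simp add: U_def)
  qed
  have "(\<lambda>n. \<Sum>t\<in>U. 1 / (of_int t)\<^sup>2 * pair_density q a t (real n / of_int t)) \<longlonglongrightarrow> W"
    unfolding W_def
  proof (intro tendsto_sum tendsto_mult tendsto_const)
    fix t assume t: "t \<in> U"
    then have "filterlim (\<lambda>n. real n * (1 / of_int t)) at_top sequentially"
      by (intro filterlim_at_top_mult_tendsto_pos[OF tendsto_const] filterlim_real_sequentially)
         (simp add: U_def)
    with pair_density_tendsto[OF assms, of t] t
    show "(\<lambda>n. pair_density q a t (real n / of_int t)) \<longlonglongrightarrow> limit_density q"
      by (auto simp: U_def intro: filterlim_compose)
  qed
  \<comment> \<open>Asymptotic equivalence is proved as a quotient tending to 1, which is why
    \<open>W > 0\<close> was established.\<close>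
  then have "(\<lambda>n. (\<Sum>t\<in>U. 1 / (of_int t)\<^sup>2 * pair_density q a t (real n / of_int t)) / W) \<longlonglongrightarrow> W / W"
    using \<open>W > 0\<close> by (intro tendsto_divide tendsto_const) auto
  moreover have "(\<Sum>t\<in>U. 1 / (of_int t)\<^sup>2 * pair_density q a t (real n / of_int t)) / W
      = real (card (ratio_set (ap_upto q a n))) / (ratio_const q * (real n ^ 2 / real_of_int q ^ 2))" for n
  proof -
    have "(\<Sum>t\<in>U. 1 / (of_int t)\<^sup>2 * pair_density q a t (real n / of_int t))
        = (\<Sum>t\<in>U. real (card (coprime_pairs q a t (real n / of_int t))) / (real n)\<^sup>2)"
      by (intro sum.cong) (auto simp: U_def pair_density_scale)
    also have "\<dots> = real (card (ratio_set (ap_upto q a n))) / (real n)\<^sup>2"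
      by (simp add: card_ratio_set_ap_upto[OF assms] U_def sum_divide_distrib)
    finally show ?thesis
      by (simp add: W mult.commute)
  qed
  ultimately show ?thesis
    using \<open>W > 0\<close> by (intro asymp_equivI') simp
qed

end
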